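(* Let $\mathcal{G}=(\mathcal{T},\mathbf{A})$ be a directed tree structure over $\mathcal{T}=\{1,\dots,k\}$ with root node $1$, given by its adjacency matrix $\mathbf{A}\in\{0,1\}^{k\times k}$, where $\mathbf{A}_{l,j}=1$ if and only if $j$ is the parent of $l$. Let $\boldsymbol\sigma\in\mathbb{R}^k$ be a vector with nonzero entries $\sigma_1,\dots,\sigma_k$. Let $\mathbf{B}\in\mathbb{R}^{k\times k}$ be the diagonal matrix with entries $0,\sigma_2^{-2},\dots,\sigma_k^{-2}$, let $\mathbf{R}\in\mathbb{R}^{k\times k}$ be the diagonal matrix with entries $\sigma_1^{-2},0,\dots,0$, and let $\mathbf{M}=\mathbf{B}\mathbf{A}+(\mathbf{B}\mathbf{A})^{\mathsf T}$. Let $k_{\mathbf{A},\boldsymbol\sigma}(t,t')=G_{t,t'}$, where $G_{i,j}$ is the $(i,j)$ entry of $$\mathbf{G}=(\mathbf{I}_{k\times k}-\mathbf{A})^{-1}\,\mathbf{S}\,\left(\mathbf{I}_{k\times k}-\mathbf{A}^{\mathsf T}\right)^{-1}$$ and $\mathbf{S}$ is the diagonal matrix with entries $\sigma_1^2,\dots,\sigma_k^2$. Let $k_{\mathbf{M},\mathbf{R}}$ be the graph-Laplacian multitask kernel of the weighted undirected graph with weight matrix $\mathbf{M}$ and regularizer $\mathbf{R}$. Then for all $\mathbf{x},\mathbf{x}'\in\mathcal{X}\subseteq\mathbb{R}^m$ and all $t,t'\in\mathcal{T}$, $$k_{\mathbf{M},\mathbf{R}}\big((\mathbf{x},t),(\mathbf{x}',t')\big)=k_{\mathbf{A},\boldsymbol\sigma}(t,t')\,\mathbf{x}^{\mathsf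 T}\mathbf{x}'.$$
   Context: Graph-Laplacian multitask kernel: let $\mathbf{M}\in\mathbb{R}^{k\times k}$ be the symmetric weighted adjacency matrix of an undirected graph over $\mathcal{T}=\{1,\dots,k\}$, where $\mathbf{M}_{i,j}>0$ is the weight of the edge between $i$ and $j$, and $\mathbf{M}_{i,j}=0$ if there is no such edge. Let $\mathbf{D}$ be the weighted degree matrix (diagonal with $\mathbf{D}_{i,i}=\sum_j\mathbf{M}_{i,j}$), let $\mathbf{R}$ be a diagonal matrix (the regularizer), and let $\mathbf{L}=\mathbf{D}+\mathbf{R}-\mathbf{M}$ be the (regularized) graph Laplacian, with (Moore–Penrose) pseudoinverse $\mathbf{L}^\dagger$. The graph-Laplacian multitask kernel $k_{\mathbf{M},\mathbf{R}}:(\mathcal{X}\times\mathcal{T})\times(\mathcal{X}\times\mathcal{T})\to\mathbb{R}$ is $$k_{\mathbf{M},\mathbf{R}}\big((\mathbf{x},t),(\mathbf{x}',t')\big)=\mathbf{L}^\dagger_{t,t'}\,\mathbf{x}^{\mathsf T}\mathbf{x}'.$$ $\mathbf{I}_{k\times k}$ denotes the identity matrix. *)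

theory Defs
  imports "HOL-Analysis.Analysis"
begin

definition diag_matrix :: "real ^ 'n \<Rightarrow> real ^ 'n ^ 'n" where
  "diag_matrix d = (\<chi> i j. if i = j then d $ i else 0)"

text \<open>The four Penrose conditions; for real matrices the adjoint is the transpose.\<close>

definition is_pseudoinverse :: "real ^ 'n ^ 'm \<Rightarrow> real ^ 'm ^ 'n \<Rightarrow> bool" where
  "is_pseudoinverse L P \<longleftrightarrow>
     L ** P ** L = L \<and>
     P ** L ** P = P \<and>
     transpose (L ** P) = L ** P \<and>
     transpose (P ** L) = P ** L"

text \<open>Every real matrix has exactly one matrix satisfying the Penrose conditions,
  so the definite description is proper.\<close>

definition pseudoinverse :: "real ^ 'n ^ 'm \<Rightarrow> real ^ 'm ^ 'n" where
  "pseudoinverse L = (THE P. is_pseudoinverse L P)"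

definition degree_matrix :: "real ^ 'k ^ 'k \<Rightarrow> real ^ 'k ^ 'k" where
  "degree_matrix M = diag_matrix (\<chi> i. \<Sum>j\<in>UNIV. M $ i $ j)"

definition regularized_laplacian :: "real ^ 'k ^ 'k \<Rightarrow> real ^ 'k ^ 'k \<Rightarrow> real ^ 'k ^ 'k" where
  "regularized_laplacian M R = degree_matrix M + R - M"

definition graph_laplacian_kernel ::
  "real ^ 'k ^ 'k \<Rightarrow> real ^ 'k ^ 'k \<Rightarrow> (real ^ 'm) \<times> 'k \<Rightarrow> (real ^ 'm) \<times> 'k \<Rightarrow> real" where
  "graph_laplacian_kernel M R = (\<lambda>(x, t) (x', t').
     pseudoinverse (regularized_laplacian M R) $ t $ t' * (x \<bullet> x'))"

text \<open>The task set is the finite index type, with \<^term>\<open>r\<close> playing the role of the task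
  numbered 1. Entry \<^term>\<open>A $ l $ j\<close> is 1 iff \<^term>\<open>j\<close> is the parent of \<^term>\<open>l\<close>, so the
  closure below follows parents upwards.\<close>

definition is_directed_tree :: "real ^ 'k ^ 'k \<Rightarrow> 'k \<Rightarrow> bool" where
  "is_directed_tree A r \<longleftrightarrow>
     (\<forall>l j. A $ l $ j \<in> {0, 1}) \<and>
     (\<forall>j. A $ r $ j \<noteq> 1) \<and>
     (\<forall>l. l \<noteq> r \<longrightarrow> (\<exists>!j. A $ l $ j = 1)) \<and>
     (\<forall>l. (l, r) \<in> {(l, j). A $ l $ j = 1}\<^sup>*)"

definition tree_gram_matrix :: "real ^ 'k ^ 'k \<Rightarrow> real ^ 'k \<Rightarrow> real ^ 'k ^ 'k" where
  "tree_gram_matrix A \<sigma> =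
     matrix_inv (mat 1 - A) ** diag_matrix (\<chi> i. (\<sigma> $ i)\<^sup>2) ** matrix_inv (mat 1 - transpose A)"

definition tree_task_kernel :: "real ^ 'k ^ 'k \<Rightarrow> real ^ 'k \<Rightarrow> 'k \<Rightarrow> 'k \<Rightarrow> real" where
  "tree_task_kernel A \<sigma> t t' = tree_gram_matrix A \<sigma> $ t $ t'"

end

theory Submission
  imports Defs
begin

text \<open>Writing \<open>C\<close> for the diagonal matrix of the inverse squares of \<open>\<sigma>\<close>, the Laplacian factors as
  \<open>(I - A)\<^sup>T C (I - A)\<close>: every row of \<open>A\<close> has at most one nonzero entry, so \<open>A\<^sup>T C A\<close> is diagonal
  and, together with \<open>C\<close>, makes up the weighted degrees and the regularizer. A vector fixed by \<open>A\<close>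
  vanishes at the root and is constant along edges, so \<open>I - A\<close> is invertible; hence so is the
  Laplacian, its inverse is the Gram matrix, and the pseudoinverse is the inverse.\<close>

lemma matrix_vector_mult_eq_if_unique:
  fixes A :: "real ^ 'n ^ 'm"
  assumes "A $ l $ j = 1" and "\<And>i. i \<noteq> j \<Longrightarrow> A $ l $ i = 0"
  shows "(A *v v) $ l = v $ j"
proof -
  have "(A *v v) $ l = (\<Sum>i\<in>UNIV. if i = j then v $ j else 0)"
    unfolding matrix_vector_mult_def vec_lambda_beta using assms by (intro sum.cong) auto
  then show ?thesis by simp
qed

lemma matrix_inv_mult:
  assumes "invertible N"
  shows "matrix_inv N ** N = mat 1" and "N ** matrix_inv N = mat 1"
  using someI_ex[OF assms[unfolded invertible_def]] by (simp_all add: matrix_inv_def)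

text \<open>Uniqueness comes from the first Penrose condition alone: multiplying
  \<open>L ** Q ** L = L\<close> by \<open>P\<close> on both sides cancels both outer factors and
  leaves \<open>Q = P\<close>.\<close>

lemma pseudoinverse_eq_inverse:
  fixes L P :: "real ^ 'n ^ 'n"
  assumes "L ** P = mat 1" and "P ** L = mat 1"
  shows "pseudoinverse L = P"
  unfolding pseudoinverse_def
proof (rule the_equality)
  show "is_pseudoinverse L P"
    by (simp add: is_pseudoinverse_def assms transpose_mat)
next
  fix Q assume "is_pseudoinverse L Q"
  then have "L ** Q ** L = L"
    by (simp add: is_pseudoinverse_def)
  then have "P ** (L ** Q ** L) ** P = P ** L ** P"
    by simp
  moreover have "P ** (L ** Q ** L) ** P = (P ** L) ** Q ** (L ** P)"
    by (simp only: matrix_mul_assoc)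
  ultimately show "Q = P"
    by (simp add: assms)
qed

lemma diag_matrix_mult_component: "(diag_matrix d ** A) $ i $ j = d $ i * A $ i $ j"
  by (simp add: matrix_matrix_mult_def diag_matrix_def if_distrib[of "\<lambda>x. x * _"] cong: if_cong)

lemma diag_matrix_mult_inverse:
  assumes "\<And>i. d $ i * e $ i = 1"
  shows "diag_matrix d ** diag_matrix e = mat 1"
  by (simp add: vec_eq_iff diag_matrix_mult_component) (simp add: diag_matrix_def mat_def assms)

context
  fixes A :: "real ^ 'k ^ 'k" and r :: 'k
  assumes tree: "is_directed_tree A r"
begin

lemma tree_entry_cases: "A $ l $ j = 0 \<or> A $ l $ j = 1"
  using tree by (auto simp: is_directed_tree_def)

lemma tree_root_row: "A $ r $ j = 0"
  using tree tree_entry_cases[of r j] by (auto simp: is_directed_tree_def)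

lemma tree_parent_unique: "A $ l $ i = 1 \<Longrightarrow> A $ l $ j = 1 \<Longrightarrow> i = j"
  using tree tree_root_row unfolding is_directed_tree_def by (metis zero_neq_one)

text \<open>A nonzero product would give \<open>l\<close> two distinct parents. This makes the
  off-diagonal entries of \<open>A\<^sup>T C A\<close> vanish.\<close>

lemma tree_row_products: "i \<noteq> j \<Longrightarrow> A $ l $ i * A $ l $ j = 0"
  using tree_entry_cases tree_parent_unique by (metis mult_eq_0_iff)

lemma tree_row_sum: "(\<Sum>j\<in>UNIV. A $ l $ j) = (if l = r then 0 else 1)"
proof (cases "l = r")
  case True
  then show ?thesis by (simp add: tree_root_row)
next
  case False
  then obtain p where "A $ l $ p = 1"
    using tree by (auto simp: is_directed_tree_def)
  then have "A $ l $ j = (if j = p then 1 else 0)" for j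
    using tree_entry_cases tree_parent_unique by metis
  then show ?thesis using False by simp
qed

lemma tree_fixed_vector_eq_0:
  assumes "A *v v = v"
  shows "v = 0"
proof -
  have root: "v $ r = 0"
  proof -
    have "(A *v v) $ r = 0"
      by (simp add: matrix_vector_mult_def tree_root_row)
    then show ?thesis using assms by simp
  qed
  have "v $ l = 0" for l
  proof -
    have "(l, r) \<in> {(l, j). A $ l $ j = 1}\<^sup>*"
      using tree by (simp add: is_directed_tree_def)
    then show ?thesis
    \<comment> \<open>The induction descends from the root: the step prepends an edge from
      \<open>l\<close> to its parent \<open>p\<close>, where \<open>v\<close> is already known to
      vanish, and the fixed-point equation gives \<open>v $ l = v $ p\<close>.\<close>
    proof (induction rule: converse_rtrancl_induct)
      case base
      show ?case by (rule root)
    next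
      case (step l p)
      then have p: "A $ l $ p = 1" by simp
      then have "\<And>i. i \<noteq> p \<Longrightarrow> A $ l $ i = 0"
        using tree_entry_cases tree_parent_unique by metis
      with p have "(A *v v) $ l = v $ p"
        by (rule matrix_vector_mult_eq_if_unique)
      then show ?case using step assms by simp
    qed
  qed
  then show ?thesis by (simp add: vec_eq_iff)
qed

lemma tree_invertible: "invertible (mat 1 - A)"
proof -
  have "\<forall>v. (mat 1 - A) *v v = 0 \<longrightarrow> v = 0"
    using tree_fixed_vector_eq_0 by (simp add: matrix_vector_mult_diff_rdistrib)
  then show ?thesis
    by (simp add: invertible_left_inverse matrix_left_invertible_ker)
qed

text \<open>Expanding the right-hand side gives
  \<open>C - C A - (C A)\<^sup>T + A\<^sup>T C A\<close> with \<open>C = diag_matrix c\<close>. The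
  mixed terms are \<open>-M\<close>; the other two are diagonal and have to be matched with degrees
  plus regularizer. Only the tree structure enters, so \<open>c\<close> is arbitrary here.\<close>

lemma tree_laplacian_factorization:
  fixes c :: "real ^ 'k"
  defines "B \<equiv> diag_matrix (\<chi> i. if i = r then 0 else c $ i)"
    and "R \<equiv> diag_matrix (\<chi> i. if i = r then c $ i else 0)"
  shows "regularized_laplacian (B ** A + transpose (B ** A)) R =
    transpose (mat 1 - A) ** diag_matrix c ** (mat 1 - A)"
proof -
  \<comment> \<open>Dropping the root entry from \<open>c\<close> is harmless because the root row
    of \<open>A\<close> is zero.\<close>
  have BA: "(B ** A) $ i $ j = c $ i * A $ i $ j" for i j
    unfolding B_def diag_matrix_mult_component by (simp add: tree_root_row)
  \<comment> \<open>The first summand is the weight of the edge from \<open>i\<close> to its parent,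
    absent at the root; the second collects the edges to the children of \<open>i\<close>.\<close>
  have deg: "(\<Sum>j\<in>UNIV. (B ** A + transpose (B ** A)) $ i $ j) =
      (if i = r then 0 else c $ i) + (\<Sum>l\<in>UNIV. c $ l * A $ l $ i)" for i
    by (simp add: BA transpose_def sum.distrib tree_row_sum flip: sum_distrib_left)
  \<comment> \<open>These are the entries of \<open>A\<^sup>T C A\<close>. On the diagonal a 0/1
    entry equals its square, which leaves exactly the child part of the degree.\<close>
  have diagonal: "(\<Sum>l\<in>UNIV. A $ l $ i * (c $ l * A $ l $ j)) =
      (if i = j then \<Sum>l\<in>UNIV. c $ l * A $ l $ i else 0)" for i j
  proof (cases "i = j")
    case True
    have "A $ l $ j * (c $ l * A $ l $ j) = c $ l * A $ l $ j" for l
      using tree_entry_cases[of l j] by auto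
    then show ?thesis by (simp only: True if_True refl)
  next
    case False
    have "A $ l $ i * (c $ l * A $ l $ j) = 0" for l
      using tree_row_products[OF False, of l] by auto
    then have "(\<Sum>l\<in>UNIV. A $ l $ i * (c $ l * A $ l $ j)) = 0"
      by (intro sum.neutral) blast
    with False show ?thesis by simp
  qed
  have "(transpose (mat 1 - A) ** diag_matrix c ** (mat 1 - A)) $ i $ j =
      (if i = j then c $ i else 0) - c $ i * A $ i $ j - c $ j * A $ j $ i +
      (\<Sum>l\<in>UNIV. A $ l $ i * (c $ l * A $ l $ j))" for i j
  proof -
    have "(transpose (mat 1 - A) ** diag_matrix c ** (mat 1 - A)) $ i $ j =
        (\<Sum>l\<in>UNIV. ((if l = i then 1 else 0) - A $ l $ i) *
          (c $ l * ((if l = j then 1 else 0) - A $ l $ j)))"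
      unfolding matrix_mul_assoc[symmetric]
      by (subst matrix_matrix_mult_def)
        (simp add: diag_matrix_mult_component, simp add: transpose_def mat_def)
    \<comment> \<open>The product is multiplied out so that each Kronecker term has a single test on
      \<open>l\<close> outermost and its sum collapses to one value.\<close>
    also have "\<dots> = (\<Sum>l\<in>UNIV. (if l = i then if i = j then c $ i else 0 else 0)
        - (if l = i then c $ i * A $ i $ j else 0) - (if l = j then c $ j * A $ j $ i else 0)
        + A $ l $ i * (c $ l * A $ l $ j))"
      by (intro sum.cong) (auto simp: algebra_simps)
    also have "\<dots> = (if i = j then c $ i else 0) - c $ i * A $ i $ j - c $ j * A $ j $ i +
        (\<Sum>l\<in>UNIV. A $ l $ i * (c $ l * A $ l $ j))"
      by (simp add: sum.distrib sum_subtractf)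
    finally show ?thesis .
  qed
  \<comment> \<open>The diagonal \<open>c $ i\<close> is uniform in \<open>i\<close>: the degree
    supplies it away from the root, and \<open>R\<close> supplies it at the root.\<close>
  moreover have "regularized_laplacian (B ** A + transpose (B ** A)) R $ i $ j =
      (if i = j then (c $ i + (\<Sum>l\<in>UNIV. c $ l * A $ l $ i)) else 0)
      - c $ i * A $ i $ j - c $ j * A $ j $ i" for i j
    unfolding regularized_laplacian_def degree_matrix_def deg
    by (simp add: diag_matrix_def R_def) (simp add: BA transpose_def)
  ultimately show ?thesis
    by (simp add: vec_eq_iff diagonal)
qed

end

theorem proposition6:
  fixes A B R M :: "real ^ 'k ^ 'k" and \<sigma> :: "real ^ 'k" and r t t' :: 'k
    and X :: "(real ^ 'm) set" and x x' :: "real ^ 'm"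
  assumes tree: "is_directed_tree A r"
    and nonzero: "\<And>i. \<sigma> $ i \<noteq> 0"
    and B: "B = diag_matrix (\<chi> i. if i = r then 0 else 1 / (\<sigma> $ i)\<^sup>2)"
    and R: "R = diag_matrix (\<chi> i. if i = r then 1 / (\<sigma> $ i)\<^sup>2 else 0)"
    and M: "M = B ** A + transpose (B ** A)"
    and "x \<in> X" and "x' \<in> X"
  shows "graph_laplacian_kernel M R (x, t) (x', t') = tree_task_kernel A \<sigma> t t' * (x \<bullet> x')"
proof -
  define c :: "real ^ 'k" where "c = (\<chi> i. 1 / (\<sigma> $ i)\<^sup>2)"
  define s :: "real ^ 'k" where "s = (\<chi> i. (\<sigma> $ i)\<^sup>2)"
  define N where "N = mat 1 - A"
  define L where "L = regularized_laplacian M R"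
  define G where "G = tree_gram_matrix A \<sigma>"
  have tN: "mat 1 - transpose A = transpose N"
    by (simp add: N_def vec_eq_iff transpose_def mat_def)
  have "invertible N"
    unfolding N_def by (rule tree_invertible[OF tree])
  then have N: "matrix_inv N ** N = mat 1" "N ** matrix_inv N = mat 1"
    and T: "matrix_inv (transpose N) ** transpose N = mat 1"
      "transpose N ** matrix_inv (transpose N) = mat 1"
    by (simp_all add: matrix_inv_mult transpose_invertible)
  have cs: "diag_matrix c ** diag_matrix s = mat 1" "diag_matrix s ** diag_matrix c = mat 1"
    by (simp_all add: diag_matrix_mult_inverse c_def s_def nonzero)
  have L: "L = transpose N ** diag_matrix c ** N"
    unfolding L_def N_def M B R tree_laplacian_factorization[OF tree, symmetric]
    by (simp add: c_def cong: if_cong)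
  have G: "G = matrix_inv N ** diag_matrix s ** matrix_inv (transpose N)"
    by (simp add: G_def tree_gram_matrix_def tN s_def N_def[symmetric])
  \<comment> \<open>Reassociation brings each factor next to its inverse, so the product telescopes
    from the inside out: \<open>N\<close>, then the diagonal matrices, then
    \<open>transpose N\<close>.\<close>
  have "L ** G = transpose N ** (diag_matrix c ** (N ** matrix_inv N) ** diag_matrix s)
      ** matrix_inv (transpose N)"
    unfolding L G by (simp only: matrix_mul_assoc)
  then have "L ** G = mat 1"
    by (simp add: N T cs)
  moreover have "G ** L = matrix_inv N ** (diag_matrix s **
      (matrix_inv (transpose N) ** transpose N) ** diag_matrix c) ** N"
    unfolding L G by (simp only: matrix_mul_assoc)
  then have "G ** L = mat 1"
    by (simp add: N T cs)
  ultimately have "pseudoinverse L = G"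
    by (rule pseudoinverse_eq_inverse)
  then show ?thesis
    by (simp add: graph_laplacian_kernel_def tree_task_kernel_def L_def G_def)
qed

end
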